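(* Let $A$ be a commutative ring with nonzero identity, let $M$ be an $A$-module, $P$ a submodule of $M$ and $I$ an ideal of $A$. Consider the $A\bowtie I$-module $M\bowtie I$. The following statements hold: (i) $P\bowtie I$ is a classical prime submodule of $M\bowtie I$ if and only if $P$ is a classical prime submodule of $M$. (ii) $P\bowtie I$ is a classical 1-absorbing prime submodule of $M\bowtie I$ if and only if $P$ is a classical 1-absorbing prime submodule of $M$. (iii) $P\bowtie I$ is a classical 2-absorbing submodule of $M\bowtie I$ if and only if $P$ is a classical 2-absorbing submodule of $M$.
   Context: All rings are commutative with nonzero identity; the given module $M$ is nonzero and unital. The amalgamated duplication of $A$ along the ideal $I$ is the subring $A\bowtie I=\{(a,a+i):a\in A,\ i\in I\}$ of $A\times A$ (componentwise operations). The amalgamated duplication of $M$ along $I$ is $M\bowtie I=\{(m,m+m^{\prime}):m\in M,\ m^{\prime}\in IM\}$, an $A\bowtie I$-module with componentwise addition and scalar multiplication $(a,a+i)(m,m+m^{\prime})=(am,(a+i)(m+m^{\prime}))$. For a submodule $P$ of $M$, $P\bowtie I=\{(m,m+m^{\prime}):m\in P,\ m^{\prime}\in IM\}$, an $A\bowtie I$-submodule of $M\bowtie I$. For a ring $R$ and an $R$-module $X$, a proper submodule $Q$ of $X$ is: a classical prime submodule if whenever $abx\in Q$ for $a,b\in R$, $x\in X$, then $ax\in Q$ or $bx\in Q$; a classical 1-absorbing prime submodule if whenever $abcx\in Q$ for nonunits $a,b,c\in R$ and $x\in X$, then $abx\in Q$ or $cx\in Q$; a classical 2-absorbing submodule if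 whenever $abcx\in Q$ for $a,b,c\in R$ and $x\in X$, then $abx\in Q$ or $acx\in Q$ or $bcx\in Q$.
   Formalization: In (ii), the direction from P classical 1-absorbing prime to P⋈I classical 1-absorbing prime is stated only for I ≠ A; it fails for I = A, e.g. A = M = Z/4, P = 0, with a = (1,0), b = c = (2,0), x = (1,1). *)

theory Defs
  imports "HOL-Algebra.Module" "HOL-Algebra.Chinese_Remainder"
begin

definition duplication_ring :: "('a, 'r) ring_scheme \<Rightarrow> 'a set \<Rightarrow> ('a \<times> 'a) ring"
  where "duplication_ring A I =
    (RDirProd A A)\<lparr>carrier := {(a, a \<oplus>\<^bsub>A\<^esub> i) | a i. a \<in> carrier A \<and> i \<in> I}\<rparr>"

(* The submodule I M, i.e. all finite sums of products i x; the same pattern as ideal_prod.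
   The empty sum needs no rule of its own, since an ideal contains zero. *)
inductive_set ideal_smult ::
    "('a, 'm, 'x) module_scheme \<Rightarrow> 'a set \<Rightarrow> 'm set"
  for M :: "('a, 'm, 'x) module_scheme" and I :: "'a set"
  where
    prod: "\<lbrakk> i \<in> I; x \<in> carrier M \<rbrakk> \<Longrightarrow> i \<odot>\<^bsub>M\<^esub> x \<in> ideal_smult M I"
  | sum: "\<lbrakk> s \<in> ideal_smult M I; t \<in> ideal_smult M I \<rbrakk> \<Longrightarrow> s \<oplus>\<^bsub>M\<^esub> t \<in> ideal_smult M I"

definition duplication_set :: "('a, 'm, 'x) module_scheme \<Rightarrow> 'a set \<Rightarrow> 'm set \<Rightarrow> ('m \<times> 'm) set"
  where "duplication_set M I P = {(m, m \<oplus>\<^bsub>M\<^esub> m') | m m'. m \<in> P \<and> m' \<in> ideal_smult M I}"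

(* Module records inherit the fields mult and one from ring records; they play no role in the
   locale module, and are filled in componentwise. *)
definition duplication_module ::
    "('a, 'm, 'x) module_scheme \<Rightarrow> 'a set \<Rightarrow> ('a \<times> 'a, 'm \<times> 'm) module"
  where "duplication_module M I =
    \<lparr>carrier = duplication_set M I (carrier M),
     mult = (\<lambda>(x, y) (x', y'). (x \<otimes>\<^bsub>M\<^esub> x', y \<otimes>\<^bsub>M\<^esub> y')),
     one = (\<one>\<^bsub>M\<^esub>, \<one>\<^bsub>M\<^esub>),
     zero = (\<zero>\<^bsub>M\<^esub>, \<zero>\<^bsub>M\<^esub>),
     add = (\<lambda>(x, y) (x', y'). (x \<oplus>\<^bsub>M\<^esub> x', y \<oplus>\<^bsub>M\<^esub> y')),
     smult = (\<lambda>(a, b) (x, y). (a \<odot>\<^bsub>M\<^esub> x, b \<odot>\<^bsub>M\<^esub> y))\<rparr>"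

definition classical_prime_submodule ::
    "('a, 'r) ring_scheme \<Rightarrow> ('a, 'm, 'x) module_scheme \<Rightarrow> 'm set \<Rightarrow> bool"
  where "classical_prime_submodule R N Q \<longleftrightarrow>
    submodule Q R N \<and> Q \<noteq> carrier N \<and>
    (\<forall>a\<in>carrier R. \<forall>b\<in>carrier R. \<forall>x\<in>carrier N.
      (a \<otimes>\<^bsub>R\<^esub> b) \<odot>\<^bsub>N\<^esub> x \<in> Q \<longrightarrow> a \<odot>\<^bsub>N\<^esub> x \<in> Q \<or> b \<odot>\<^bsub>N\<^esub> x \<in> Q)"

definition classical_1_absorbing_prime_submodule ::
    "('a, 'r) ring_scheme \<Rightarrow> ('a, 'm, 'x) module_scheme \<Rightarrow> 'm set \<Rightarrow> bool"
  where "classical_1_absorbing_prime_submodule R N Q \<longleftrightarrow>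
    submodule Q R N \<and> Q \<noteq> carrier N \<and>
    (\<forall>a\<in>carrier R - Units R. \<forall>b\<in>carrier R - Units R. \<forall>c\<in>carrier R - Units R. \<forall>x\<in>carrier N.
      (a \<otimes>\<^bsub>R\<^esub> b \<otimes>\<^bsub>R\<^esub> c) \<odot>\<^bsub>N\<^esub> x \<in> Q \<longrightarrow>
        (a \<otimes>\<^bsub>R\<^esub> b) \<odot>\<^bsub>N\<^esub> x \<in> Q \<or> c \<odot>\<^bsub>N\<^esub> x \<in> Q)"

definition classical_2_absorbing_submodule ::
    "('a, 'r) ring_scheme \<Rightarrow> ('a, 'm, 'x) module_scheme \<Rightarrow> 'm set \<Rightarrow> bool"
  where "classical_2_absorbing_submodule R N Q \<longleftrightarrow>
    submodule Q R N \<and> Q \<noteq> carrier N \<and>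
    (\<forall>a\<in>carrier R. \<forall>b\<in>carrier R. \<forall>c\<in>carrier R. \<forall>x\<in>carrier N.
      (a \<otimes>\<^bsub>R\<^esub> b \<otimes>\<^bsub>R\<^esub> c) \<odot>\<^bsub>N\<^esub> x \<in> Q \<longrightarrow>
        (a \<otimes>\<^bsub>R\<^esub> b) \<odot>\<^bsub>N\<^esub> x \<in> Q \<or> (a \<otimes>\<^bsub>R\<^esub> c) \<odot>\<^bsub>N\<^esub> x \<in> Q \<or> (b \<otimes>\<^bsub>R\<^esub> c) \<odot>\<^bsub>N\<^esub> x \<in> Q)"

end

theory Submission
  imports Defs
begin

text \<open>
  Write \<open>D\<close> for the duplicated ring.  Everything rests on one observation: an element of the
  duplicated module lies in the duplicate of \<open>P\<close> iff its first component lies in \<open>P\<close>, because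
  the second component only carries a condition that all elements of the duplicated module
  satisfy anyway (\<open>mem_duplicate_iff\<close>).  The first projection is moreover
  multiplicative and has the diagonal, also multiplicative, as a section.  Hence a condition of
  the form ``whenever a product of scalars sends \<open>x\<close> into the submodule, so does one of certain
  partial products'' holds for the duplicate of \<open>P\<close> over \<open>D\<close> iff it holds for \<open>P\<close> over \<open>A\<close>: it is
  pulled back along the projection and restricted along the diagonal.  This settles the classical
  prime and the classical 2-absorbing case.

  The 1-absorbing condition restricts the scalars to nonunits.  The diagonal preserves nonunits,
  so one implication is as before.  The projection need not: \<open>(u, u \<oplus> i)\<close> can be a nonunit while
  \<open>u\<close> is a unit.  Two facts repair this when \<open>I\<close> is proper.  If \<open>P\<close> is classical 1-absorbing
  prime but not classical prime, then \<open>A\<close> is local, in the sense that the sum of a nonunit and a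
  unit is a unit (\<open>nonunit_plus_unit\<close>); as \<open>I\<close> consists of nonunits, \<open>u \<oplus> i\<close> is then a unit
  and so is the pair (\<open>fst_nonunit\<close>).  If \<open>P\<close> is classical prime, then the stronger condition, without
  any restriction on the scalars, passes to the duplicate.
\<close>

section \<open>Classical 1-absorbing prime submodules that are not classical prime\<close>

lemma (in module) unit_smult_cancel:
  assumes P: "submodule P R M" and u: "u \<in> Units R" and x: "x \<in> carrier M"
    and ux: "u \<odot>\<^bsub>M\<^esub> x \<in> P"
  shows "x \<in> P"
proof -
  have "inv\<^bsub>R\<^esub> u \<odot>\<^bsub>M\<^esub> (u \<odot>\<^bsub>M\<^esub> x) \<in> P"
    using submoduleE(4)[OF P] ux u by blast
  moreover have "inv\<^bsub>R\<^esub> u \<odot>\<^bsub>M\<^esub> (u \<odot>\<^bsub>M\<^esub> x) = x"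
    using u x by (simp add: smult_assoc1[symmetric] R.Units_closed)
  ultimately show ?thesis by simp
qed

text \<open>
  Let \<open>a \<otimes> b\<close> send \<open>x\<close> into \<open>P\<close> while neither \<open>a\<close> nor \<open>b\<close> does.  Both are
  nonunits, since a unit could be cancelled from \<open>a \<otimes> b\<close>.
  For every nonunit \<open>d\<close>, the condition applied to \<open>d\<close>, \<open>a\<close>, \<open>b\<close> gives that \<open>d \<otimes> a\<close> sends \<open>x\<close> into
  \<open>P\<close>.  If \<open>c\<close> and \<open>c \<oplus> u\<close> were both nonunits, then \<open>u \<otimes> a\<close> would send \<open>x\<close> into \<open>P\<close> by
  subtraction, and cancelling the unit \<open>u\<close> would give a contradiction.
\<close>

lemma (in module) nonunit_plus_unit:
  assumes P1: "classical_1_absorbing_prime_submodule R M P"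
    and not_prime: "\<not> classical_prime_submodule R M P"
    and c: "c \<in> carrier R - Units R" and u: "u \<in> Units R"
  shows "c \<oplus> u \<in> Units R"
proof (rule ccontr)
  assume cu: "c \<oplus> u \<notin> Units R"
  have P: "submodule P R M"
    using P1 by (simp add: classical_1_absorbing_prime_submodule_def)
  have c': "c \<in> carrier R" and u': "u \<in> carrier R"
    using c u by auto
  obtain a b x where a: "a \<in> carrier R" and b: "b \<in> carrier R" and x: "x \<in> carrier M"
    and abx: "(a \<otimes> b) \<odot>\<^bsub>M\<^esub> x \<in> P" and ax: "a \<odot>\<^bsub>M\<^esub> x \<notin> P" and bx: "b \<odot>\<^bsub>M\<^esub> x \<notin> P"
    using P1 not_prime
    unfolding classical_prime_submodule_def classical_1_absorbing_prime_submodule_def by blast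
  have a_nonunit: "a \<notin> Units R"
    using unit_smult_cancel[OF P, of a "b \<odot>\<^bsub>M\<^esub> x"] abx bx a b x
    by (auto simp: smult_assoc1)
  have b_nonunit: "b \<notin> Units R"
    using unit_smult_cancel[OF P, of b "a \<odot>\<^bsub>M\<^esub> x"] abx ax a b x
    by (auto simp: smult_assoc1 R.m_comm[of a b])
  have absorb: "d \<odot>\<^bsub>M\<^esub> (a \<odot>\<^bsub>M\<^esub> x) \<in> P" if d: "d \<in> carrier R - Units R" for d
  proof -
    have "(d \<otimes> a \<otimes> b) \<odot>\<^bsub>M\<^esub> x = d \<odot>\<^bsub>M\<^esub> ((a \<otimes> b) \<odot>\<^bsub>M\<^esub> x)"
      using d a b x by (simp add: smult_assoc1)
    hence "(d \<otimes> a \<otimes> b) \<odot>\<^bsub>M\<^esub> x \<in> P"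
      using submoduleE(4)[OF P] abx d by simp
    hence "(d \<otimes> a) \<odot>\<^bsub>M\<^esub> x \<in> P"
      using P1 d a b x bx a_nonunit b_nonunit
      unfolding classical_1_absorbing_prime_submodule_def by blast
    thus ?thesis using d a x by (simp add: smult_assoc1)
  qed
  let ?y = "a \<odot>\<^bsub>M\<^esub> x"
  have y: "?y \<in> carrier M" using a x by simp
  have "(c \<oplus> u) \<odot>\<^bsub>M\<^esub> ?y \<oplus>\<^bsub>M\<^esub> (\<ominus>\<^bsub>M\<^esub> (c \<odot>\<^bsub>M\<^esub> ?y)) \<in> P"
    using submoduleE(3,5)[OF P] absorb[OF c] absorb[of "c \<oplus> u"] cu c' u' by simp
  moreover have "(c \<oplus> u) \<odot>\<^bsub>M\<^esub> ?y \<oplus>\<^bsub>M\<^esub> (\<ominus>\<^bsub>M\<^esub> (c \<odot>\<^bsub>M\<^esub> ?y)) = u \<odot>\<^bsub>M\<^esub> ?y"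
    using smult_closed[OF c' y] smult_closed[OF u' y]
    by (simp add: smult_l_distr[OF c' u' y] M.a_comm[of "c \<odot>\<^bsub>M\<^esub> ?y"] M.a_assoc M.r_neg)
  ultimately have "?y \<in> P"
    using unit_smult_cancel[OF P u y] by simp
  thus False using ax by simp
qed

section \<open>The duplicated ring\<close>

lemma duplication_ring_mult [simp]:
  "(a, b) \<otimes>\<^bsub>duplication_ring A I\<^esub> (c, d) = (a \<otimes>\<^bsub>A\<^esub> c, b \<otimes>\<^bsub>A\<^esub> d)"
  by (simp add: duplication_ring_def RDirProd_def monoid.defs)

lemma duplication_ring_one [simp]: "\<one>\<^bsub>duplication_ring A I\<^esub> = (\<one>\<^bsub>A\<^esub>, \<one>\<^bsub>A\<^esub>)"
  by (simp add: duplication_ring_def RDirProd_def monoid.defs)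

lemma mem_duplication_ring:
  "p \<in> carrier (duplication_ring A I) \<longleftrightarrow> (\<exists>a i. p = (a, a \<oplus>\<^bsub>A\<^esub> i) \<and> a \<in> carrier A \<and> i \<in> I)"
  by (auto simp: duplication_ring_def)

locale duplication = module A M + ideal I A
  for A :: "('a, 'r) ring_scheme" (structure) and M :: "('a, 'm, 'x) module_scheme" (structure)
    and I :: "'a set"
begin

abbreviation "D \<equiv> duplication_ring A I"
abbreviation "N \<equiv> duplication_module M I"
abbreviation "IM \<equiv> ideal_smult M I"
abbreviation "dup \<equiv> duplication_set M I"

lemma diagonal_in_D: "a \<in> carrier A \<Longrightarrow> (a, a) \<in> carrier D"
  using additive_subgroup.zero_closed[OF is_additive_subgroup]
  by (auto simp: mem_duplication_ring intro!: exI[of _ "\<zero>\<^bsub>A\<^esub>"])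

lemma D_mult_closed:
  assumes "p \<in> carrier D" "q \<in> carrier D"
  shows "p \<otimes>\<^bsub>D\<^esub> q \<in> carrier D"
proof -
  obtain a i where p: "p = (a, a \<oplus>\<^bsub>A\<^esub> i)" and a: "a \<in> carrier A" and i: "i \<in> I"
    using assms(1) by (auto simp: mem_duplication_ring)
  obtain b j where q: "q = (b, b \<oplus>\<^bsub>A\<^esub> j)" and b: "b \<in> carrier A" and j: "j \<in> I"
    using assms(2) by (auto simp: mem_duplication_ring)
  have ij: "i \<in> carrier A" "j \<in> carrier A" using i j Icarr by auto
  have "(a \<oplus>\<^bsub>A\<^esub> i) \<otimes>\<^bsub>A\<^esub> (b \<oplus>\<^bsub>A\<^esub> j)
      = a \<otimes>\<^bsub>A\<^esub> b \<oplus>\<^bsub>A\<^esub> (a \<otimes>\<^bsub>A\<^esub> j \<oplus>\<^bsub>A\<^esub> i \<otimes>\<^bsub>A\<^esub> (b \<oplus>\<^bsub>A\<^esub> j))"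
    using a b ij by (simp add: R.l_distr R.r_distr R.a_ac)
  moreover have "a \<otimes>\<^bsub>A\<^esub> j \<oplus>\<^bsub>A\<^esub> i \<otimes>\<^bsub>A\<^esub> (b \<oplus>\<^bsub>A\<^esub> j) \<in> I"
    using a b i j ij I_l_closed I_r_closed a_closed by simp
  ultimately show ?thesis
    using p q a b by (auto simp: mem_duplication_ring)
qed

lemma fst_D_mult: "fst (p \<otimes>\<^bsub>D\<^esub> q) = fst p \<otimes>\<^bsub>A\<^esub> fst q"
  by (cases p; cases q) simp

lemma fst_D_closed: "p \<in> carrier D \<Longrightarrow> fst p \<in> carrier A"
  by (auto simp: mem_duplication_ring)

lemma diagonal_unit_iff:
  assumes "a \<in> carrier A"
  shows "(a, a) \<in> Units D \<longleftrightarrow> a \<in> Units A"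
proof
  assume "(a, a) \<in> Units D"
  then obtain q where q: "q \<in> carrier D" "q \<otimes>\<^bsub>D\<^esub> (a, a) = \<one>\<^bsub>D\<^esub>" "(a, a) \<otimes>\<^bsub>D\<^esub> q = \<one>\<^bsub>D\<^esub>"
    unfolding Units_def by auto
  hence "fst q \<otimes>\<^bsub>A\<^esub> a = \<one>\<^bsub>A\<^esub>" "a \<otimes>\<^bsub>A\<^esub> fst q = \<one>\<^bsub>A\<^esub>"
    by (cases q, simp)+
  thus "a \<in> Units A"
    using assms fst_D_closed[OF q(1)] unfolding Units_def by auto
next
  assume "a \<in> Units A"
  then obtain b where "b \<in> carrier A" "b \<otimes>\<^bsub>A\<^esub> a = \<one>\<^bsub>A\<^esub>" "a \<otimes>\<^bsub>A\<^esub> b = \<one>\<^bsub>A\<^esub>"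
    unfolding Units_def by auto
  thus "(a, a) \<in> Units D"
    using diagonal_in_D assms unfolding Units_def by (auto intro!: bexI[of _ "(b, b)"])
qed

text \<open>
  The componentwise inverse lies in \<open>D\<close> again, since two inverses differ by
  \<open>(u \<oplus> i)\<^sup>-\<^sup>1 - u\<^sup>-\<^sup>1 = - i u\<^sup>-\<^sup>1 (u \<oplus> i)\<^sup>-\<^sup>1\<close>, an element of \<open>I\<close>.
\<close>

lemma unit_pair_in_Units:
  assumes u: "u \<in> Units A" and i: "i \<in> I" and ui: "u \<oplus>\<^bsub>A\<^esub> i \<in> Units A"
  shows "(u, u \<oplus>\<^bsub>A\<^esub> i) \<in> Units D"
proof -
  define v where "v = inv\<^bsub>A\<^esub> u"
  define w where "w = inv\<^bsub>A\<^esub> (u \<oplus>\<^bsub>A\<^esub> i)"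
  have i': "i \<in> carrier A" using i Icarr by auto
  have carr: "u \<in> carrier A" "v \<in> carrier A" "w \<in> carrier A"
    using u ui by (auto simp: v_def w_def)
  have v: "v \<otimes>\<^bsub>A\<^esub> u = \<one>\<^bsub>A\<^esub>" "u \<otimes>\<^bsub>A\<^esub> v = \<one>\<^bsub>A\<^esub>"
    and w: "w \<otimes>\<^bsub>A\<^esub> (u \<oplus>\<^bsub>A\<^esub> i) = \<one>\<^bsub>A\<^esub>" "(u \<oplus>\<^bsub>A\<^esub> i) \<otimes>\<^bsub>A\<^esub> w = \<one>\<^bsub>A\<^esub>"
    using u ui by (auto simp: v_def w_def)
  define j where "j = \<ominus>\<^bsub>A\<^esub> (v \<otimes>\<^bsub>A\<^esub> w \<otimes>\<^bsub>A\<^esub> i)"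
  have j: "j \<in> I"
    using i carr I_l_closed a_inv_closed by (simp add: j_def)
  have j': "j \<in> carrier A" using j Icarr by auto
  have "v = v \<otimes>\<^bsub>A\<^esub> (w \<otimes>\<^bsub>A\<^esub> (u \<oplus>\<^bsub>A\<^esub> i))" using carr w by simp
  also have "\<dots> = (v \<otimes>\<^bsub>A\<^esub> u) \<otimes>\<^bsub>A\<^esub> w \<oplus>\<^bsub>A\<^esub> v \<otimes>\<^bsub>A\<^esub> w \<otimes>\<^bsub>A\<^esub> i"
    using carr i' by (simp add: R.r_distr R.m_ac)
  also have "\<dots> = w \<oplus>\<^bsub>A\<^esub> v \<otimes>\<^bsub>A\<^esub> w \<otimes>\<^bsub>A\<^esub> i" using carr v by simp
  finally have "v \<oplus>\<^bsub>A\<^esub> j = w"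
    using carr i' by (metis R.add.inv_solve_right R.m_closed j_def)
  hence "(v, w) \<in> carrier D"
    using carr j by (auto simp: mem_duplication_ring)
  moreover have "(u, u \<oplus>\<^bsub>A\<^esub> i) \<in> carrier D"
    using carr i by (auto simp: mem_duplication_ring)
  ultimately show ?thesis
    using v w unfolding Units_def by (auto intro!: bexI[of _ "(v, w)"])
qed

text \<open>
  A proper ideal consists of nonunits, so in a local ring a unit stays a unit when an element of
  \<open>I\<close> is added to it.  A pair whose first component is a unit therefore has two unit components.
\<close>

lemma fst_nonunit:
  assumes local: "\<And>c u. c \<in> carrier A - Units A \<Longrightarrow> u \<in> Units A \<Longrightarrow> c \<oplus>\<^bsub>A\<^esub> u \<in> Units A"
    and proper: "I \<noteq> carrier A" and p: "p \<in> carrier D - Units D"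
  shows "fst p \<in> carrier A - Units A"
proof -
  obtain a i where p_eq: "p = (a, a \<oplus>\<^bsub>A\<^esub> i)" and a: "a \<in> carrier A" and i: "i \<in> I"
    using p by (auto simp: mem_duplication_ring)
  have i': "i \<in> carrier A" using i Icarr by auto
  have "i \<notin> Units A"
  proof
    assume "i \<in> Units A"
    hence "\<one>\<^bsub>A\<^esub> \<in> I" using I_r_closed[OF i, of "inv\<^bsub>A\<^esub> i"] by simp
    thus False using one_imp_carrier proper by simp
  qed
  hence "a \<oplus>\<^bsub>A\<^esub> i \<in> Units A" if "a \<in> Units A"
    using local[of i a] that i' a by (simp add: R.a_comm)
  hence "a \<notin> Units A"
    using unit_pair_in_Units[OF _ i] p p_eq by auto
  thus ?thesis using a p_eq by simp
qed

section \<open>The duplicated module\<close>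

lemma N_carrier [simp]: "carrier N = dup (carrier M)"
  by (simp add: duplication_module_def)

lemma N_smult [simp]: "p \<odot>\<^bsub>N\<^esub> x = (fst p \<odot>\<^bsub>M\<^esub> fst x, snd p \<odot>\<^bsub>M\<^esub> snd x)"
  by (simp add: duplication_module_def split_beta)

lemma ideal_smult_submodule: "submodule IM A M"
proof (rule submoduleI)
  show sub: "IM \<subseteq> carrier M"
  proof
    fix s assume "s \<in> IM"
    thus "s \<in> carrier M"
      by induction (use Icarr in auto)
  qed
  show "\<zero>\<^bsub>M\<^esub> \<in> IM"
    using ideal_smult.prod[of "\<zero>\<^bsub>A\<^esub>" I "\<zero>\<^bsub>M\<^esub>" M] additive_subgroup.zero_closed[OF is_additive_subgroup]
    by simp
  show "s \<oplus>\<^bsub>M\<^esub> t \<in> IM" if "s \<in> IM" "t \<in> IM" for s t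
    using that by (rule ideal_smult.sum)
  show smult: "a \<odot>\<^bsub>M\<^esub> s \<in> IM" if a: "a \<in> carrier A" and s: "s \<in> IM" for a s
    using s
  proof induction
    case (prod i x)
    have "a \<odot>\<^bsub>M\<^esub> (i \<odot>\<^bsub>M\<^esub> x) = (a \<otimes>\<^bsub>A\<^esub> i) \<odot>\<^bsub>M\<^esub> x"
      using a prod Icarr by (simp add: smult_assoc1)
    thus ?case using a prod I_l_closed by (auto intro: ideal_smult.prod)
  next
    case (sum s t)
    have "a \<odot>\<^bsub>M\<^esub> (s \<oplus>\<^bsub>M\<^esub> t) = a \<odot>\<^bsub>M\<^esub> s \<oplus>\<^bsub>M\<^esub> a \<odot>\<^bsub>M\<^esub> t"
      using a sum sub by (intro smult_r_distr) auto
    thus ?case using sum by (auto intro: ideal_smult.sum)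
  qed
  show "\<ominus>\<^bsub>M\<^esub> s \<in> IM" if "s \<in> IM" for s
  proof -
    have "(\<ominus>\<^bsub>A\<^esub> \<one>\<^bsub>A\<^esub>) \<odot>\<^bsub>M\<^esub> s = \<ominus>\<^bsub>M\<^esub> s"
      using that sub by (subst smult_l_minus) auto
    thus ?thesis using smult[OF _ that, of "\<ominus>\<^bsub>A\<^esub> \<one>\<^bsub>A\<^esub>"] by simp
  qed
qed

lemmas IM_carrier = subsetD[OF submoduleE(1)[OF ideal_smult_submodule]]
  and IM_neg = submoduleE(3)[OF ideal_smult_submodule]
  and IM_smult = submoduleE(4)[OF ideal_smult_submodule]
  and IM_add = submoduleE(5)[OF ideal_smult_submodule]

lemma mem_dup: "x \<in> dup P \<longleftrightarrow> (\<exists>m m'. x = (m, m \<oplus>\<^bsub>M\<^esub> m') \<and> m \<in> P \<and> m' \<in> IM)"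
  by (auto simp: duplication_set_def)

lemma mem_duplicate_iff:
  assumes "x \<in> carrier N" and "P \<subseteq> carrier M"
  shows "x \<in> dup P \<longleftrightarrow> fst x \<in> P"
  using assms by (auto simp: mem_dup)

lemma fst_N_closed: "x \<in> carrier N \<Longrightarrow> fst x \<in> carrier M"
  by (auto simp: mem_dup)

lemma diagonal_in_dup:
  assumes "m \<in> P" "P \<subseteq> carrier M" shows "(m, m) \<in> dup P"
proof -
  have "\<zero>\<^bsub>M\<^esub> \<in> IM"
    using submodule.axioms(1)[OF ideal_smult_submodule] subgroup.one_closed by fastforce
  thus ?thesis using assms by (auto simp: mem_dup intro!: exI[of _ "\<zero>\<^bsub>M\<^esub>"])
qed

lemma dup_smult_closed:
  assumes P: "submodule P A M" and p: "p \<in> carrier D" and x: "x \<in> dup P"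
  shows "p \<odot>\<^bsub>N\<^esub> x \<in> dup P"
proof -
  obtain a i where p_eq: "p = (a, a \<oplus>\<^bsub>A\<^esub> i)" and a: "a \<in> carrier A" and i: "i \<in> I"
    using p by (auto simp: mem_duplication_ring)
  obtain m m' where x_eq: "x = (m, m \<oplus>\<^bsub>M\<^esub> m')" and m: "m \<in> P" and m': "m' \<in> IM"
    using x by (auto simp: mem_dup)
  have carr: "i \<in> carrier A" "m \<in> carrier M" "m' \<in> carrier M"
    using i m m' Icarr IM_carrier submoduleE(1)[OF P] by auto
  have "(a \<oplus>\<^bsub>A\<^esub> i) \<odot>\<^bsub>M\<^esub> (m \<oplus>\<^bsub>M\<^esub> m')
      = a \<odot>\<^bsub>M\<^esub> m \<oplus>\<^bsub>M\<^esub> (a \<odot>\<^bsub>M\<^esub> m' \<oplus>\<^bsub>M\<^esub> i \<odot>\<^bsub>M\<^esub> (m \<oplus>\<^bsub>M\<^esub> m'))"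
    using a carr by (simp add: smult_l_distr smult_r_distr M.a_ac)
  moreover have "a \<odot>\<^bsub>M\<^esub> m' \<oplus>\<^bsub>M\<^esub> i \<odot>\<^bsub>M\<^esub> (m \<oplus>\<^bsub>M\<^esub> m') \<in> IM"
    using a i m' carr IM_smult IM_add ideal_smult.prod[of i I _ M] by simp
  moreover have "a \<odot>\<^bsub>M\<^esub> m \<in> P" using submoduleE(4)[OF P] a m by simp
  ultimately show ?thesis
    using p_eq x_eq by (auto simp: mem_dup)
qed

text \<open>
  Applied to \<open>P\<close> and to the whole of \<open>M\<close>, this makes both duplicates subgroups of the additive
  group of \<open>M \<times> M\<close>, so that the inverses in the duplicated module are the componentwise ones.
\<close>

lemma dup_subgroup:
  assumes P: "submodule P A M"
  shows "subgroup (dup P) (add_monoid M \<times>\<times> add_monoid M)"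
proof -
  interpret MM: group "add_monoid M \<times>\<times> add_monoid M"
    by (intro DirProd_group M.a_group)
  have PM: "\<And>m. m \<in> P \<Longrightarrow> m \<in> carrier M" using submoduleE(1)[OF P] by auto
  show ?thesis
  proof (rule MM.subgroupI)
    show "dup P \<subseteq> carrier (add_monoid M \<times>\<times> add_monoid M)"
      using PM IM_carrier by (auto simp: mem_dup)
    show "dup P \<noteq> {}"
      using submoduleE(1,2)[OF P] diagonal_in_dup[of _ P] by blast
  next
    fix x assume "x \<in> dup P"
    then obtain m m' where x: "x = (m, m \<oplus>\<^bsub>M\<^esub> m')" and m: "m \<in> P" and m': "m' \<in> IM"
      by (auto simp: mem_dup)
    have carr: "m \<in> carrier M" "m' \<in> carrier M" using m m' PM IM_carrier by auto
    have "inv\<^bsub>add_monoid M \<times>\<times> add_monoid M\<^esub> x = (\<ominus>\<^bsub>M\<^esub> m, \<ominus>\<^bsub>M\<^esub> m \<oplus>\<^bsub>M\<^esub> \<ominus>\<^bsub>M\<^esub> m')"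
      using carr x M.minus_add[OF carr] inv_DirProd[OF M.a_group M.a_group, of m "m \<oplus>\<^bsub>M\<^esub> m'"]
      by (simp add: a_inv_def)
    thus "inv\<^bsub>add_monoid M \<times>\<times> add_monoid M\<^esub> x \<in> dup P"
      using submoduleE(3)[OF P] m m' IM_neg by (auto simp: mem_dup)
  next
    fix x y assume "x \<in> dup P" "y \<in> dup P"
    then obtain m m' n n' where x: "x = (m, m \<oplus>\<^bsub>M\<^esub> m')" and m: "m \<in> P" and m': "m' \<in> IM"
      and y: "y = (n, n \<oplus>\<^bsub>M\<^esub> n')" and n: "n \<in> P" and n': "n' \<in> IM"
      by (auto simp: mem_dup)
    have "(m \<oplus>\<^bsub>M\<^esub> m') \<oplus>\<^bsub>M\<^esub> (n \<oplus>\<^bsub>M\<^esub> n') = (m \<oplus>\<^bsub>M\<^esub> n) \<oplus>\<^bsub>M\<^esub> (m' \<oplus>\<^bsub>M\<^esub> n')"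
      using m m' n n' PM IM_carrier by (simp add: M.a_ac)
    thus "x \<otimes>\<^bsub>add_monoid M \<times>\<times> add_monoid M\<^esub> y \<in> dup P"
      using x y submoduleE(5)[OF P m n] IM_add[OF m' n'] by (auto simp: mem_dup)
  qed
qed

lemma dup_submodule:
  assumes P: "submodule P A M"
  shows "submodule (dup P) D N"
proof (intro submodule.intro submodule_axioms.intro)
  interpret MM: group "add_monoid M \<times>\<times> add_monoid M"
    by (intro DirProd_group M.a_group)
  let ?G = "(add_monoid M \<times>\<times> add_monoid M)\<lparr>carrier := dup (carrier M)\<rparr>"
  have "dup P \<subseteq> dup (carrier M)"
    using submoduleE(1)[OF P] unfolding duplication_set_def by blast
  hence "subgroup (dup P) ?G"
    using dup_subgroup[OF P] dup_subgroup[OF carrier_is_submodule] by (intro MM.subgroup_incl)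
  \<comment> \<open>\<open>add_monoid N\<close> and \<open>?G\<close> have the same operations but different record types.\<close>
  thus "subgroup (dup P) (add_monoid N)"
    by (simp add: subgroup_def m_inv_def duplication_module_def DirProd_def)
  show "\<And>p x. p \<in> carrier D \<Longrightarrow> x \<in> dup P \<Longrightarrow> p \<odot>\<^bsub>N\<^esub> x \<in> dup P"
    by (rule dup_smult_closed[OF P])
qed

lemma dup_proper_iff:
  assumes "submodule P A M"
  shows "dup P \<noteq> carrier N \<longleftrightarrow> P \<noteq> carrier M"
proof -
  have "carrier M \<subseteq> P" if eq: "dup P = carrier N"
  proof
    fix m assume "m \<in> carrier M"
    hence "(m, m) \<in> dup P" using diagonal_in_dup[of m "carrier M"] eq by simp
    thus "m \<in> P" by (auto simp: mem_dup)
  qed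
  thus ?thesis using submoduleE(1)[OF assms] by auto
qed

section \<open>Transfer of the absorption conditions\<close>

lemma smult_mem_dup_iff:
  assumes P: "submodule P A M" and p: "p \<in> carrier D" and x: "x \<in> carrier N"
  shows "p \<odot>\<^bsub>N\<^esub> x \<in> dup P \<longleftrightarrow> fst p \<odot>\<^bsub>M\<^esub> fst x \<in> P"
proof -
  have "p \<odot>\<^bsub>N\<^esub> x \<in> carrier N"
    using dup_smult_closed[OF carrier_is_submodule p] x by simp
  thus ?thesis using mem_duplicate_iff submoduleE(1)[OF P] by simp
qed

lemma diagonal_smult_mem_dup_iff:
  assumes P: "submodule P A M" and a: "a \<in> carrier A" and x: "x \<in> carrier M"
  shows "(a, a) \<odot>\<^bsub>N\<^esub> (x, x) \<in> dup P \<longleftrightarrow> a \<odot>\<^bsub>M\<^esub> x \<in> P"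
  using smult_mem_dup_iff[OF P diagonal_in_D[OF a], of "(x, x)"] diagonal_in_dup[of x "carrier M"] x
  by simp

lemma classical_prime_duplication_iff:
  assumes P: "submodule P A M"
  shows "classical_prime_submodule D N (dup P) \<longleftrightarrow> classical_prime_submodule A M P"
proof
  assume L: "classical_prime_submodule D N (dup P)"
  have "a \<odot>\<^bsub>M\<^esub> x \<in> P \<or> b \<odot>\<^bsub>M\<^esub> x \<in> P"
    if carr: "a \<in> carrier A" "b \<in> carrier A" "x \<in> carrier M"
      and abx: "(a \<otimes>\<^bsub>A\<^esub> b) \<odot>\<^bsub>M\<^esub> x \<in> P" for a b x
  proof -
    have "((a, a) \<otimes>\<^bsub>D\<^esub> (b, b)) \<odot>\<^bsub>N\<^esub> (x, x) \<in> dup P"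
      using carr abx diagonal_smult_mem_dup_iff[OF P, of "a \<otimes>\<^bsub>A\<^esub> b" x]
      by (simp del: N_smult)
    hence "(a, a) \<odot>\<^bsub>N\<^esub> (x, x) \<in> dup P \<or> (b, b) \<odot>\<^bsub>N\<^esub> (x, x) \<in> dup P"
      using L carr diagonal_in_D diagonal_in_dup[of x "carrier M"]
      unfolding classical_prime_submodule_def N_carrier by blast
    thus ?thesis using carr diagonal_smult_mem_dup_iff[OF P] by blast
  qed
  thus "classical_prime_submodule A M P"
    using L P dup_proper_iff[OF P] unfolding classical_prime_submodule_def by blast
next
  assume R: "classical_prime_submodule A M P"
  have "p \<odot>\<^bsub>N\<^esub> x \<in> dup P \<or> q \<odot>\<^bsub>N\<^esub> x \<in> dup P"
    if carr: "p \<in> carrier D" "q \<in> carrier D" "x \<in> carrier N"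
      and pqx: "(p \<otimes>\<^bsub>D\<^esub> q) \<odot>\<^bsub>N\<^esub> x \<in> dup P" for p q x
  proof -
    have "(fst p \<otimes>\<^bsub>A\<^esub> fst q) \<odot>\<^bsub>M\<^esub> fst x \<in> P"
      using carr pqx smult_mem_dup_iff[OF P D_mult_closed] fst_D_mult by metis
    hence "fst p \<odot>\<^bsub>M\<^esub> fst x \<in> P \<or> fst q \<odot>\<^bsub>M\<^esub> fst x \<in> P"
      using R carr fst_D_closed fst_N_closed unfolding classical_prime_submodule_def by blast
    thus ?thesis using carr smult_mem_dup_iff[OF P] by blast
  qed
  thus "classical_prime_submodule D N (dup P)"
    using R dup_submodule[OF P] dup_proper_iff[OF P] unfolding classical_prime_submodule_def by blast
qed

lemma classical_2_absorbing_duplication_iff: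
  assumes P: "submodule P A M"
  shows "classical_2_absorbing_submodule D N (dup P) \<longleftrightarrow> classical_2_absorbing_submodule A M P"
proof
  assume L: "classical_2_absorbing_submodule D N (dup P)"
  have "(a \<otimes>\<^bsub>A\<^esub> b) \<odot>\<^bsub>M\<^esub> x \<in> P \<or> (a \<otimes>\<^bsub>A\<^esub> c) \<odot>\<^bsub>M\<^esub> x \<in> P \<or> (b \<otimes>\<^bsub>A\<^esub> c) \<odot>\<^bsub>M\<^esub> x \<in> P"
    if carr: "a \<in> carrier A" "b \<in> carrier A" "c \<in> carrier A" "x \<in> carrier M"
      and abcx: "(a \<otimes>\<^bsub>A\<^esub> b \<otimes>\<^bsub>A\<^esub> c) \<odot>\<^bsub>M\<^esub> x \<in> P" for a b c x
  proof -
    have "((a, a) \<otimes>\<^bsub>D\<^esub> (b, b) \<otimes>\<^bsub>D\<^esub> (c, c)) \<odot>\<^bsub>N\<^esub> (x, x) \<in> dup P"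
      using carr abcx diagonal_smult_mem_dup_iff[OF P, of "a \<otimes>\<^bsub>A\<^esub> b \<otimes>\<^bsub>A\<^esub> c" x]
      by (simp del: N_smult)
    hence "((a, a) \<otimes>\<^bsub>D\<^esub> (b, b)) \<odot>\<^bsub>N\<^esub> (x, x) \<in> dup P \<or> ((a, a) \<otimes>\<^bsub>D\<^esub> (c, c)) \<odot>\<^bsub>N\<^esub> (x, x) \<in> dup P
        \<or> ((b, b) \<otimes>\<^bsub>D\<^esub> (c, c)) \<odot>\<^bsub>N\<^esub> (x, x) \<in> dup P"
      using L carr diagonal_in_D diagonal_in_dup[of x "carrier M"]
      unfolding classical_2_absorbing_submodule_def N_carrier by blast
    thus ?thesis
      using carr diagonal_smult_mem_dup_iff[OF P] by (simp del: N_smult)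
  qed
  thus "classical_2_absorbing_submodule A M P"
    using L P dup_proper_iff[OF P] unfolding classical_2_absorbing_submodule_def by blast
next
  assume R: "classical_2_absorbing_submodule A M P"
  have "(p \<otimes>\<^bsub>D\<^esub> q) \<odot>\<^bsub>N\<^esub> x \<in> dup P \<or> (p \<otimes>\<^bsub>D\<^esub> r) \<odot>\<^bsub>N\<^esub> x \<in> dup P \<or> (q \<otimes>\<^bsub>D\<^esub> r) \<odot>\<^bsub>N\<^esub> x \<in> dup P"
    if carr: "p \<in> carrier D" "q \<in> carrier D" "r \<in> carrier D" "x \<in> carrier N"
      and pqrx: "(p \<otimes>\<^bsub>D\<^esub> q \<otimes>\<^bsub>D\<^esub> r) \<odot>\<^bsub>N\<^esub> x \<in> dup P" for p q r x
  proof -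
    have "(fst p \<otimes>\<^bsub>A\<^esub> fst q \<otimes>\<^bsub>A\<^esub> fst r) \<odot>\<^bsub>M\<^esub> fst x \<in> P"
      using carr pqrx smult_mem_dup_iff[OF P] D_mult_closed fst_D_mult by metis
    hence "(fst p \<otimes>\<^bsub>A\<^esub> fst q) \<odot>\<^bsub>M\<^esub> fst x \<in> P \<or> (fst p \<otimes>\<^bsub>A\<^esub> fst r) \<odot>\<^bsub>M\<^esub> fst x \<in> P
        \<or> (fst q \<otimes>\<^bsub>A\<^esub> fst r) \<odot>\<^bsub>M\<^esub> fst x \<in> P"
      using R carr fst_D_closed fst_N_closed unfolding classical_2_absorbing_submodule_def by blast
    thus ?thesis
      using carr smult_mem_dup_iff[OF P D_mult_closed] by (simp del: N_smult N_carrier add: fst_D_mult)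
  qed
  thus "classical_2_absorbing_submodule D N (dup P)"
    using R dup_submodule[OF P] dup_proper_iff[OF P]
    unfolding classical_2_absorbing_submodule_def by blast
qed

lemma classical_1_absorbing_from_duplication:
  assumes P: "submodule P A M"
    and L: "classical_1_absorbing_prime_submodule D N (dup P)"
  shows "classical_1_absorbing_prime_submodule A M P"
proof -
  have "(a \<otimes>\<^bsub>A\<^esub> b) \<odot>\<^bsub>M\<^esub> x \<in> P \<or> c \<odot>\<^bsub>M\<^esub> x \<in> P"
    if nonunits: "a \<in> carrier A - Units A" "b \<in> carrier A - Units A" "c \<in> carrier A - Units A"
      and x: "x \<in> carrier M" and abcx: "(a \<otimes>\<^bsub>A\<^esub> b \<otimes>\<^bsub>A\<^esub> c) \<odot>\<^bsub>M\<^esub> x \<in> P" for a b c x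
  proof -
    have diagonal: "\<And>d. d \<in> carrier A - Units A \<Longrightarrow> (d, d) \<in> carrier D - Units D"
      using diagonal_in_D diagonal_unit_iff by blast
    have "((a, a) \<otimes>\<^bsub>D\<^esub> (b, b) \<otimes>\<^bsub>D\<^esub> (c, c)) \<odot>\<^bsub>N\<^esub> (x, x) \<in> dup P"
      using nonunits x abcx diagonal_smult_mem_dup_iff[OF P, of "a \<otimes>\<^bsub>A\<^esub> b \<otimes>\<^bsub>A\<^esub> c" x]
      by (simp del: N_smult)
    hence "((a, a) \<otimes>\<^bsub>D\<^esub> (b, b)) \<odot>\<^bsub>N\<^esub> (x, x) \<in> dup P \<or> (c, c) \<odot>\<^bsub>N\<^esub> (x, x) \<in> dup P"
      using L nonunits[THEN diagonal] x diagonal_in_dup[of x "carrier M"]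
      unfolding classical_1_absorbing_prime_submodule_def N_carrier by blast
    thus ?thesis
      using nonunits x diagonal_smult_mem_dup_iff[OF P] by (simp del: N_smult)
  qed
  thus ?thesis
    using L P dup_proper_iff[OF P] unfolding classical_1_absorbing_prime_submodule_def by blast
qed

text \<open>
  Properness of \<open>I\<close> cannot be dropped: for \<open>I = A\<close> the duplicated ring is \<open>A \<times> A\<close>, where
  \<open>(1, 0)\<close> is a nonunit with unit first component.  This ring is not local, so over it classical
  1-absorbing prime already means classical prime.
\<close>

lemma classical_1_absorbing_to_duplication:
  assumes P: "submodule P A M" and proper: "I \<noteq> carrier A"
    and R: "classical_1_absorbing_prime_submodule A M P"
  shows "classical_1_absorbing_prime_submodule D N (dup P)"
proof -
  have absorb: "(fst p \<otimes>\<^bsub>A\<^esub> fst q) \<odot>\<^bsub>M\<^esub> y \<in> P \<or> fst r \<odot>\<^bsub>M\<^esub> y \<in> P"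
    if pqr: "p \<in> carrier D - Units D" "q \<in> carrier D - Units D" "r \<in> carrier D - Units D"
      and y: "y \<in> carrier M" and pqry: "(fst p \<otimes>\<^bsub>A\<^esub> fst q \<otimes>\<^bsub>A\<^esub> fst r) \<odot>\<^bsub>M\<^esub> y \<in> P" for p q r y
  proof (cases "classical_prime_submodule A M P")
    case True
    moreover have "fst p \<otimes>\<^bsub>A\<^esub> fst q \<in> carrier A" "fst r \<in> carrier A"
      using pqr fst_D_closed by auto
    ultimately show ?thesis
      using pqry y unfolding classical_prime_submodule_def by blast
  next
    case False
    have "\<And>s. s \<in> carrier D - Units D \<Longrightarrow> fst s \<in> carrier A - Units A"
      using fst_nonunit[OF nonunit_plus_unit[OF R False] proper] by blast
    thus ?thesis
      using R pqr y pqry unfolding classical_1_absorbing_prime_submodule_def by blast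
  qed
  have "(p \<otimes>\<^bsub>D\<^esub> q) \<odot>\<^bsub>N\<^esub> x \<in> dup P \<or> r \<odot>\<^bsub>N\<^esub> x \<in> dup P"
    if pqr: "p \<in> carrier D - Units D" "q \<in> carrier D - Units D" "r \<in> carrier D - Units D"
      and x: "x \<in> carrier N" and pqrx: "(p \<otimes>\<^bsub>D\<^esub> q \<otimes>\<^bsub>D\<^esub> r) \<odot>\<^bsub>N\<^esub> x \<in> dup P" for p q r x
  proof -
    have carr: "p \<in> carrier D" "q \<in> carrier D" "r \<in> carrier D" using pqr by auto
    have "(fst p \<otimes>\<^bsub>A\<^esub> fst q \<otimes>\<^bsub>A\<^esub> fst r) \<odot>\<^bsub>M\<^esub> fst x \<in> P"
      using carr x pqrx smult_mem_dup_iff[OF P] D_mult_closed fst_D_mult by metis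
    hence "(fst p \<otimes>\<^bsub>A\<^esub> fst q) \<odot>\<^bsub>M\<^esub> fst x \<in> P \<or> fst r \<odot>\<^bsub>M\<^esub> fst x \<in> P"
      by (rule absorb[OF pqr fst_N_closed[OF x]])
    thus ?thesis
      using carr x smult_mem_dup_iff[OF P] D_mult_closed
      by (simp del: N_smult N_carrier add: fst_D_mult)
  qed
  thus ?thesis
    using R dup_submodule[OF P] dup_proper_iff[OF P]
    unfolding classical_1_absorbing_prime_submodule_def by blast
qed

end

theorem theorem12:
  fixes A :: "('a, 'r) ring_scheme"
    and M :: "('a, 'm, 'x) module_scheme"
    and I :: "'a set" and P :: "'m set"
  assumes "cring A" and "\<one>\<^bsub>A\<^esub> \<noteq> \<zero>\<^bsub>A\<^esub>"
    and "module A M" and "carrier M \<noteq> {\<zero>\<^bsub>M\<^esub>}"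
    and "submodule P A M"
    and "ideal I A"
  shows
    "(classical_prime_submodule (duplication_ring A I) (duplication_module M I) (duplication_set M I P)
        \<longleftrightarrow> classical_prime_submodule A M P)
   \<and> (classical_1_absorbing_prime_submodule
          (duplication_ring A I) (duplication_module M I) (duplication_set M I P)
        \<longrightarrow> classical_1_absorbing_prime_submodule A M P)
   \<and> (I \<noteq> carrier A \<longrightarrow>
        (classical_1_absorbing_prime_submodule
            (duplication_ring A I) (duplication_module M I) (duplication_set M I P)
          \<longleftrightarrow> classical_1_absorbing_prime_submodule A M P))
   \<and> (classical_2_absorbing_submodule
          (duplication_ring A I) (duplication_module M I) (duplication_set M I P)
        \<longleftrightarrow> classical_2_absorbing_submodule A M P)"
proof -
  interpret duplication A M I
    using assms by (intro duplication.intro)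
  note P = \<open>submodule P A M\<close>
  show ?thesis
    using classical_prime_duplication_iff[OF P] classical_2_absorbing_duplication_iff[OF P]
      classical_1_absorbing_from_duplication[OF P] classical_1_absorbing_to_duplication[OF P]
    by blast
qed

end
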